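(* Let $L>0$, $\mu>0$, let $f:\mathbb{R}^d\to\mathbb{R}$ be convex and differentiable with $L$-Lipschitz continuous gradient, let $h:\mathbb{R}^d\to\mathbb{R}\cup\{+\infty\}$ be closed, proper and convex, and let $F=f+h$ have a nonempty set of global minimizers, with minimum value $F_*$. Let $x_1\in\mathbb{R}^d$, and suppose that for the step sizes $\gamma\in(0,\frac2L)$ under consideration $\|\mathcal{G}_\gamma(x)\|^2\ge2\mu(F(x)-F_* )$ for all $x$ with $F(x)\le F(x_1)$, where $\mathcal{G}_\gamma(x)=\frac1\gamma\left(x-\mathrm{prox}_{\gamma h}(x-\gamma\nabla f(x))\right)$. Define the worst-case rate bound $\tau:(0,\frac2L)\to\mathbb{R}$ by $$\tau(\gamma)=\begin{cases}\dfrac{1-\gamma\mu}{1+\gamma\mu}, & \gamma\in\left(0,\frac1L\right],\\[2ex] \dfrac{-2L\gamma^2\mu+L\gamma+3\gamma\mu-2}{L\gamma-\gamma\mu-2}, & \gamma\in\left(\frac1L,\frac{3}{2L}\right],\\[2ex] \dfrac{(L\gamma-1)^2}{(L\gamma-1)^2-L\gamma^2\mu+2\gamma\mu}, & \gamma\in\left(\frac{3}{2L},\frac2L\right).\end{cases}$$ Then the optimal step size for this bound, i.e. the minimizer of $\tau$ over $(0,\frac2L)$, is $\gamma=\frac{3}{2L}$ if $\mu\le\frac L9$, and is $\gamma=\frac{2}{\sqrt L(\sqrt L+\sqrt\mu)}$ if $\frac L9<\mu<L$.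
   Context: For a closed proper convex function $g$, $\mathrm{prox}_{g}(x)=\operatorname{argmin}_{y\in\mathbb{R}^d}\{g(y)+\frac12\|y-x\|^2\}$. The function $\tau(\gamma)$ is the contraction factor in the bound $F(x_2)-F_*\le\tau(\gamma)(F(x_1)-F_* )$ for one proximal gradient step $x_2=\mathrm{prox}_{\gamma h}(x_1-\gamma\nabla f(x_1))$. "Optimal" step size means the one minimizing this bound; the constants $L,\mu$ are fixed as $\gamma$ varies. "The step sizes under consideration" are all $\gamma\in(0,\frac2L)$. *)

theory Defs
  imports "HOL-Analysis.Analysis"
begin

definition gradient :: "('a::euclidean_space \<Rightarrow> real) \<Rightarrow> 'a \<Rightarrow> 'a" where
  "gradient f x = (THE D. GDERIV f x :> D)"

lemma GDERIV_gradient: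
  assumes "f differentiable (at x)"
  shows "GDERIV f x :> gradient f x"
proof -
  obtain f' where f': "(f has_derivative f') (at x)"
    using assms by (auto simp: differentiable_def)
  then interpret bounded_linear f' by (rule has_derivative_bounded_linear)
  have "f' = (\<lambda>h. h \<bullet> adjoint f' 1)"
    using adjoint_works[OF linear_axioms, of _ 1] by (simp add: fun_eq_iff)
  then have D: "GDERIV f x :> adjoint f' 1"
    using f' by (simp add: gderiv_def)
  have "D' = adjoint f' 1" if "GDERIV f x :> D'" for D'
  proof -
    have "(\<lambda>h. h \<bullet> D') = (\<lambda>h. h \<bullet> adjoint f' 1)"
      using that D has_derivative_unique unfolding gderiv_def by blast
    then show ?thesis
      by (simp add: fun_eq_iff vector_eq_ldot)
  qed
  then show ?thesis
    unfolding gradient_def using D by (rule theI[rotated])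
qed

definition ereal_epigraph :: "('a \<Rightarrow> ereal) \<Rightarrow> ('a \<times> real) set" where
  "ereal_epigraph g = {(x, r). g x \<le> ereal r}"

definition closed_proper_convex :: "('a::euclidean_space \<Rightarrow> ereal) \<Rightarrow> bool" where
  "closed_proper_convex g \<longleftrightarrow>
     closed (ereal_epigraph g) \<and>
     (\<forall>x. g x \<noteq> -\<infinity>) \<and> (\<exists>x. g x \<noteq> \<infinity>) \<and>
     convex (ereal_epigraph g)"

definition prox :: "('a::euclidean_space \<Rightarrow> ereal) \<Rightarrow> 'a \<Rightarrow> 'a" where
  "prox g x = (ARG_MIN (\<lambda>y. g y + ereal (1 / 2 * (norm (y - x))\<^sup>2)) y. True)"

definition gradient_mapping ::
    "('a::euclidean_space \<Rightarrow> real) \<Rightarrow> ('a \<Rightarrow> ereal) \<Rightarrow> real \<Rightarrow> 'a \<Rightarrow> 'a" where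
  "gradient_mapping f h \<gamma> x =
     (1 / \<gamma>) *\<^sub>R (x - prox (\<lambda>y. ereal \<gamma> * h y) (x - \<gamma> *\<^sub>R gradient f x))"

text \<open>Only the values for \<open>\<gamma> \<in> {0<..<2 / L}\<close> are meaningful; all denominators are
  nonzero there when \<open>L, \<mu> > 0\<close>.\<close>

definition rate_bound :: "real \<Rightarrow> real \<Rightarrow> real \<Rightarrow> real" where
  "rate_bound L \<mu> \<gamma> =
     (if \<gamma> \<le> 1 / L then (1 - \<gamma> * \<mu>) / (1 + \<gamma> * \<mu>)
      else if \<gamma> \<le> 3 / (2 * L) then
        (- 2 * L * \<gamma>\<^sup>2 * \<mu> + L * \<gamma> + 3 * \<gamma> * \<mu> - 2) / (L * \<gamma> - \<gamma> * \<mu> - 2)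
      else (L * \<gamma> - 1)\<^sup>2 / ((L * \<gamma> - 1)\<^sup>2 - L * \<gamma>\<^sup>2 * \<mu> + 2 * \<gamma> * \<mu>))"

end

theory Submission
  imports Defs
begin

text \<open>
  The claim is a minimisation over the single variable \<open>\<gamma>\<close> of the explicit function
  \<open>\<tau> = rate_bound L \<mu>\<close>.

  In the scaled variables \<open>m = \<mu> / L\<close> and \<open>t = L * \<gamma>\<close>, which range over positive numbers and
  over \<open>(0, 2)\<close>, the three rational pieces of \<open>\<tau>\<close> become simple after passing to
  \<open>R = 1 / (1 - \<tau>)\<close>, which increases with \<open>\<tau>\<close>. By partial fractions, the middle piece is
  \<open>R = (1 / (m * t) + 1 / (2 - t)) / 2\<close>. On the first piece the term \<open>1 / (2 - t)\<close> is replaced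
  by its upper bound \<open>1\<close>, and on the last piece \<open>R\<close> exceeds the same expression
  by \<open>(1 / m - 1) * (1 / (2 * (2 - t)) - 1)\<close>, which is nonnegative for \<open>m < 1\<close>, \<open>t \<ge> 3 / 2\<close>.
  So the middle expression bounds \<open>R\<close> from below on all of \<open>(0, 2)\<close>.

  Completing a square shows that this lower bound has the unique minimiser
  \<open>t = 2 / (1 + sqrt m)\<close>. If \<open>1 / 9 < m < 1\<close>, this point lies in the middle interval, where
  the lower bound is attained, and so it is also the unique minimiser of \<open>R\<close>. If \<open>m \<le> 1 / 9\<close>,
  the lower bound is still decreasing up to \<open>t = 3 / 2\<close>, while \<open>R\<close> increases beyond that
  point because \<open>t * (2 - t)\<close> decreases there.
\<close>

text \<open>\<open>1 / (1 - \<tau>)\<close> on the middle piece, in scaled variables, considered on all of \<open>(0, 2)\<close>.\<close>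
definition middle_inverse_gain :: "real \<Rightarrow> real \<Rightarrow> real" where
  "middle_inverse_gain m t = (1 / (m * t) + 1 / (2 - t)) / 2"

text \<open>\<open>1 / (1 - \<tau>)\<close> in scaled variables.\<close>
definition inverse_gain :: "real \<Rightarrow> real \<Rightarrow> real" where
  "inverse_gain m t =
     (if t \<le> 1 then (1 / (m * t) + 1) / 2
      else if t \<le> 3 / 2 then middle_inverse_gain m t
      else 1 + (1 / (t * (2 - t)) - 1) / m)"

lemma rate_bound_rescale:
  assumes "L > 0"
  shows "rate_bound L \<mu> \<gamma> = rate_bound 1 (\<mu> / L) (L * \<gamma>)"
proof -
  have 1: "\<gamma> \<le> 1 / L \<longleftrightarrow> L * \<gamma> \<le> 1" and 2: "\<gamma> \<le> 3 / (2 * L) \<longleftrightarrow> L * \<gamma> \<le> 3 / 2"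
    using assms by (simp_all add: field_simps)
  have "L * \<gamma> * (\<mu> / L) = \<gamma> * \<mu>" "(L * \<gamma>)\<^sup>2 * (\<mu> / L) = L * \<gamma>\<^sup>2 * \<mu>"
    using assms by (simp_all add: power2_eq_square)
  then show ?thesis
    using 1 2 by (simp add: rate_bound_def mult.assoc)
qed

lemma rate_bound_eq_inverse_gain:
  assumes m: "0 < m" and t: "0 < t" "t < 2"
  shows "rate_bound 1 m t = 1 - 1 / inverse_gain m t"
proof -
  consider "t \<le> 1" | "1 < t" "t \<le> 3 / 2" | "3 / 2 < t" by linarith
  then show ?thesis
  proof cases
    case 1
    have p: "m * t > 0" using m t by simp
    then have "1 / (m * t) + 1 = (1 + m * t) / (m * t)"
      using m t by (simp add: add_divide_distrib)
    then have "(1 - t * m) / (1 + t * m) = 1 - 1 / ((1 / (m * t) + 1) / 2)"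
      using p by (simp add: diff_divide_eq_iff mult.commute)
    then show ?thesis
      using 1 by (simp add: rate_bound_def inverse_gain_def)
  next
    case 2
    have gain: "middle_inverse_gain m t = (2 - t + m * t) / (2 * m * t * (2 - t))"
      using m t by (simp add: middle_inverse_gain_def field_simps)
    have pos: "2 - t + m * t > 0" using m t by (simp add: add_pos_pos)
    have "(- 2 * t\<^sup>2 * m + t + 3 * t * m - 2) / (t - t * m - 2) =
        (- (2 - t + m * t - 2 * m * t * (2 - t))) / (- (2 - t + m * t))"
      by (rule arg_cong2[where f = "(/)"]) (simp_all add: algebra_simps power2_eq_square)
    also have "\<dots> = 1 - 2 * m * t * (2 - t) / (2 - t + m * t)"
      using pos by (simp only: minus_divide_divide diff_divide_distrib) simp
    finally have "(- 2 * t\<^sup>2 * m + t + 3 * t * m - 2) / (t - t * m - 2) =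
        1 - 2 * m * t * (2 - t) / (2 - t + m * t)" .
    then show ?thesis
      using 2 gain by (simp add: rate_bound_def inverse_gain_def)
  next
    case 3
    have p: "t * (2 - t) > 0" using t by simp
    have den: "(t - 1)\<^sup>2 + m * (t * (2 - t)) > 0"
      using m p by (simp add: add_nonneg_pos)
    have gain: "1 + (1 / (t * (2 - t)) - 1) / m =
        ((t - 1)\<^sup>2 + m * (t * (2 - t))) / (m * (t * (2 - t)))"
      using m t by (simp add: divide_simps) (simp add: algebra_simps power2_eq_square)
    have "(t - 1)\<^sup>2 - t\<^sup>2 * m + 2 * t * m = (t - 1)\<^sup>2 + m * (t * (2 - t))"
      by (simp add: algebra_simps power2_eq_square)
    then have "(t - 1)\<^sup>2 / ((t - 1)\<^sup>2 - t\<^sup>2 * m + 2 * t * m) =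
        1 - m * (t * (2 - t)) / ((t - 1)\<^sup>2 + m * (t * (2 - t)))"
      using den by (simp add: diff_divide_eq_iff)
    then show ?thesis
      using 3 gain by (simp add: rate_bound_def inverse_gain_def)
  qed
qed

lemma middle_inverse_gain_pos:
  assumes "0 < m" "0 < t" "t < 2"
  shows "0 < middle_inverse_gain m t"
  using assms by (simp add: middle_inverse_gain_def add_pos_pos)

lemma middle_inverse_gain_le_inverse_gain:
  assumes m: "0 < m" "m < 1" and t: "0 < t" "t < 2"
  shows "middle_inverse_gain m t \<le> inverse_gain m t"
proof -
  consider "t \<le> 1" | "1 < t" "t \<le> 3 / 2" | "3 / 2 < t" by linarith
  then show ?thesis
  proof cases
    case 1
    then have "1 / (2 - t) \<le> 1" by simp
    then show ?thesis
      unfolding inverse_gain_def middle_inverse_gain_def using 1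
      by (simp only: if_True) (intro divide_right_mono add_left_mono, simp_all)
  next
    case 2
    then show ?thesis by (simp add: inverse_gain_def)
  next
    case 3
    have "1 / m - 1 \<ge> 0" "1 / (2 * (2 - t)) - 1 \<ge> 0"
      using m t 3 by (simp_all add: field_simps)
    then have "0 \<le> (1 / m - 1) * (1 / (2 * (2 - t)) - 1)"
      by (rule mult_nonneg_nonneg)
    also have "\<dots> = inverse_gain m t - middle_inverse_gain m t"
      using m t 3
      by (simp add: inverse_gain_def middle_inverse_gain_def divide_simps)
        (simp add: algebra_simps power2_eq_square)
    finally show ?thesis by simp
  qed
qed

text \<open>
  By the Cauchy--Schwarz inequality with weights \<open>t + (2 - t) = 2\<close>,
  \<open>2 * (1 / (r\<^sup>2 * t) + 1 / (2 - t)) \<ge> (1 / r + 1)\<^sup>2\<close>, with equality only if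
  \<open>2 - t = r * t\<close>; the difference of the two sides is
  \<open>((1 + r) * t - 2)\<^sup>2\<close> divided by a positive number.
\<close>
lemma middle_inverse_gain_unique_min:
  assumes r: "0 < r" and t: "0 < t" "t < 2" "t \<noteq> 2 / (1 + r)"
  shows "middle_inverse_gain (r\<^sup>2) (2 / (1 + r)) < middle_inverse_gain (r\<^sup>2) t"
proof -
  have "2 - 2 / (1 + r) = 2 * r / (1 + r)"
    using r by (simp add: field_simps)
  then have "middle_inverse_gain (r\<^sup>2) (2 / (1 + r)) = (1 + r)\<^sup>2 / (4 * r\<^sup>2)"
    using r by (simp add: middle_inverse_gain_def divide_simps)
      (simp add: algebra_simps power2_eq_square)
  moreover have "middle_inverse_gain (r\<^sup>2) t - (1 + r)\<^sup>2 / (4 * r\<^sup>2) =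
      ((1 + r) * t - 2)\<^sup>2 / (4 * r\<^sup>2 * (t * (2 - t)))"
    using r t by (simp add: middle_inverse_gain_def divide_simps)
      (simp add: algebra_simps power2_eq_square)
  moreover have "(1 + r) * t - 2 \<noteq> 0"
    using r t by (simp add: field_simps)
  then have "((1 + r) * t - 2)\<^sup>2 / (4 * r\<^sup>2 * (t * (2 - t))) > 0"
    using r t by simp
  ultimately show ?thesis by linarith
qed

lemma middle_inverse_gain_decreasing:
  assumes m: "0 < m" "m \<le> 1 / 9" and t: "0 < t" "t < 3 / 2"
  shows "middle_inverse_gain m (3 / 2) < middle_inverse_gain m t"
proof -
  have "m * t \<le> 1 / 9 * (3 / 2)"
    using m t by (intro mult_mono) simp_all
  \<comment> \<open>Going from \<open>t\<close> to \<open>3 / 2\<close>, the two reciprocals change by \<open>(3 - 2 * t) / (3 * (m * t))\<close> downwards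
    and \<open>(3 - 2 * t) / (2 - t)\<close> upwards; the next step compares the denominators.\<close>
  then have "3 * (m * t) < 2 - t"
    using t by simp
  then have "1 / (2 - t) < 1 / (3 * (m * t))"
    using m t by (intro divide_strict_left_mono) simp_all
  then have "(3 - 2 * t) * (1 / (2 - t)) < (3 - 2 * t) * (1 / (3 * (m * t)))"
    using t by (intro mult_strict_left_mono) simp_all
  moreover have "(3 - 2 * t) * (1 / (2 - t)) = 2 - 1 / (2 - t)"
    using t by (simp add: field_simps)
  moreover have "(3 - 2 * t) * (1 / (3 * (m * t))) = 1 / (m * t) - 2 / (3 * m)"
    using m t by (simp add: field_simps)
  ultimately have "2 / (3 * m) + 2 < 1 / (m * t) + 1 / (2 - t)"
    by linarith
  then show ?thesis
    by (simp add: middle_inverse_gain_def mult.commute)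
qed

lemma inverse_gain_increasing:
  assumes m: "0 < m" and t: "3 / 2 < t" "t < 2"
  shows "inverse_gain m (3 / 2) < inverse_gain m t"
proof -
  have "0 < (t - 3 / 2) * (t - 1 / 2)" using t by simp
  also have "\<dots> = 3 / 4 - t * (2 - t)" by (simp add: field_simps)
  finally have "t * (2 - t) < 3 / 4" by simp
  moreover have "t * (2 - t) > 0" using t by simp
  ultimately have "4 / 3 < 1 / (t * (2 - t))"
    by (simp add: less_divide_eq)
  then have "(4 / 3 - 1) / m < (1 / (t * (2 - t)) - 1) / m"
    using m by (intro divide_strict_right_mono diff_strict_right_mono)
  then have "1 + (4 / 3 - 1) / m < inverse_gain m t"
    using t by (simp add: inverse_gain_def)
  moreover have "inverse_gain m (3 / 2) = 1 + (4 / 3 - 1) / m"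
    by (simp add: inverse_gain_def middle_inverse_gain_def field_simps)
  ultimately show ?thesis by simp
qed

lemma inverse_gain_unique_min_ill_conditioned:
  assumes m: "0 < m" "m \<le> 1 / 9" and t: "0 < t" "t < 2" "t \<noteq> 3 / 2"
  shows "inverse_gain m (3 / 2) < inverse_gain m t"
proof (cases "t < 3 / 2")
  case True
  have "inverse_gain m (3 / 2) = middle_inverse_gain m (3 / 2)"
    by (simp add: inverse_gain_def)
  also have "\<dots> < middle_inverse_gain m t"
    using m t True by (intro middle_inverse_gain_decreasing)
  also have "\<dots> \<le> inverse_gain m t"
    using m t by (intro middle_inverse_gain_le_inverse_gain) simp_all
  finally show ?thesis .
next
  case False
  then show ?thesis using m t by (intro inverse_gain_increasing) simp_all
qed

lemma inverse_gain_unique_min_well_conditioned: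
  assumes m: "1 / 9 < m" "m < 1" and t: "0 < t" "t < 2" "t \<noteq> 2 / (1 + sqrt m)"
  shows "inverse_gain m (2 / (1 + sqrt m)) < inverse_gain m t"
proof -
  define r where "r = sqrt m"
  have r2: "r\<^sup>2 = m" and r: "0 < r" "r < 1"
    using m by (simp_all add: r_def)
  have "1 / 3 < r"
    using m unfolding r_def by (intro real_less_rsqrt) (simp add: power2_eq_square)
  \<comment> \<open>The two bounds on \<open>m\<close> say that the critical point lies in the middle interval.\<close>
  then have "1 < 2 / (1 + r)" "2 / (1 + r) \<le> 3 / 2"
    using r by (simp_all add: field_simps)
  then have "inverse_gain m (2 / (1 + r)) = middle_inverse_gain m (2 / (1 + r))"
    by (simp add: inverse_gain_def)
  also have "\<dots> < middle_inverse_gain m t"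
    using middle_inverse_gain_unique_min[of r t] r t r2 by (simp add: r_def)
  also have "\<dots> \<le> inverse_gain m t"
    using m t by (intro middle_inverse_gain_le_inverse_gain) simp_all
  finally show ?thesis by (simp add: r_def)
qed

lemma arg_min_rate_bound_eqI:
  assumes L: "0 < L" and \<mu>: "0 < \<mu>" "\<mu> < L" and s: "0 < s" "s < 2"
    and min: "\<And>t. 0 < t \<Longrightarrow> t < 2 \<Longrightarrow> t \<noteq> s \<Longrightarrow> inverse_gain (\<mu> / L) s < inverse_gain (\<mu> / L) t"
  shows "{\<gamma>. is_arg_min (rate_bound L \<mu>) (\<lambda>\<gamma>. \<gamma> \<in> {0<..<2 / L}) \<gamma>} = {s / L}"
proof -
  have m: "0 < \<mu> / L" "\<mu> / L < 1" using L \<mu> by simp_all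
  have less: "rate_bound L \<mu> (s / L) < rate_bound L \<mu> \<gamma>"
    if \<gamma>: "\<gamma> \<in> {0<..<2 / L}" "\<gamma> \<noteq> s / L" for \<gamma>
  proof -
    have t: "0 < L * \<gamma>" "L * \<gamma> < 2" "L * \<gamma> \<noteq> s"
      using \<gamma> L by (auto simp: field_simps)
    have "0 < inverse_gain (\<mu> / L) s"
      using middle_inverse_gain_pos[OF m(1) s] middle_inverse_gain_le_inverse_gain[OF m s]
      by linarith
    then have "1 - 1 / inverse_gain (\<mu> / L) s < 1 - 1 / inverse_gain (\<mu> / L) (L * \<gamma>)"
      using min[OF t] by (simp add: frac_less2)
    then show ?thesis
      using L m s t
      by (simp add: rate_bound_rescale[OF L, of \<mu>] rate_bound_eq_inverse_gain)
  qed
  have s': "s / L \<in> {0<..<2 / L}"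
    using L s by (simp add: divide_strict_right_mono)
  then have "is_arg_min (rate_bound L \<mu>) (\<lambda>\<gamma>. \<gamma> \<in> {0<..<2 / L}) (s / L)"
    unfolding is_arg_min_def by (metis less order_less_asym order_less_irrefl)
  moreover have "\<gamma> = s / L" if "is_arg_min (rate_bound L \<mu>) (\<lambda>\<gamma>. \<gamma> \<in> {0<..<2 / L}) \<gamma>" for \<gamma>
    using that s' less unfolding is_arg_min_def by metis
  ultimately show ?thesis by blast
qed

theorem proposition8:
  fixes f :: "real ^ 'd \<Rightarrow> real" and h F :: "real ^ 'd \<Rightarrow> ereal"
    and x1 :: "real ^ 'd" and L \<mu> :: real and Fstar :: ereal
  assumes "L > 0" and "\<mu> > 0"
    and "convex_on UNIV f"
    and "\<And>x. f differentiable (at x)"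
    and "L-lipschitz_on UNIV (gradient f)"
    and "closed_proper_convex h"
    and "F = (\<lambda>x. ereal (f x) + h x)"
    and "\<exists>z. is_arg_min F (\<lambda>_. True) z \<and> F z = Fstar"
    and "\<And>\<gamma> x. \<gamma> \<in> {0<..<2 / L} \<Longrightarrow> F x \<le> F x1 \<Longrightarrow>
           ereal ((norm (gradient_mapping f h \<gamma> x))\<^sup>2) \<ge> ereal (2 * \<mu>) * (F x - Fstar)"
  shows "(\<mu> \<le> L / 9 \<longrightarrow>
            {\<gamma>. is_arg_min (rate_bound L \<mu>) (\<lambda>\<gamma>. \<gamma> \<in> {0<..<2 / L}) \<gamma>} = {3 / (2 * L)}) \<and>
         (L / 9 < \<mu> \<and> \<mu> < L \<longrightarrow>
            {\<gamma>. is_arg_min (rate_bound L \<mu>) (\<lambda>\<gamma>. \<gamma> \<in> {0<..<2 / L}) \<gamma>} =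
              {2 / (sqrt L * (sqrt L + sqrt \<mu>))})"
proof (intro conjI impI)
  assume \<mu>: "\<mu> \<le> L / 9"
  have "{\<gamma>. is_arg_min (rate_bound L \<mu>) (\<lambda>\<gamma>. \<gamma> \<in> {0<..<2 / L}) \<gamma>} = {(3 / 2) / L}"
    using \<open>L > 0\<close> \<open>\<mu> > 0\<close> \<mu>
    by (intro arg_min_rate_bound_eqI inverse_gain_unique_min_ill_conditioned)
      (simp_all add: field_simps)
  then show "{\<gamma>. is_arg_min (rate_bound L \<mu>) (\<lambda>\<gamma>. \<gamma> \<in> {0<..<2 / L}) \<gamma>} = {3 / (2 * L)}"
    by simp
next
  assume \<mu>: "L / 9 < \<mu> \<and> \<mu> < L"
  define r where "r = sqrt (\<mu> / L)"
  define s where "s = 2 / (1 + r)"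
  have m: "1 / 9 < \<mu> / L" "\<mu> / L < 1"
    using \<open>L > 0\<close> \<mu> by (simp_all add: field_simps)
  have "0 < r"
    using \<open>L > 0\<close> \<open>\<mu> > 0\<close> by (simp add: r_def)
  then have s: "0 < s" "s < 2"
    by (simp_all add: s_def field_simps)
  have "{\<gamma>. is_arg_min (rate_bound L \<mu>) (\<lambda>\<gamma>. \<gamma> \<in> {0<..<2 / L}) \<gamma>} = {s / L}"
    using \<open>L > 0\<close> \<open>\<mu> > 0\<close> \<mu> s inverse_gain_unique_min_well_conditioned[OF m]
    by (intro arg_min_rate_bound_eqI) (simp_all add: s_def r_def)
  also have "s / L = 2 / (sqrt L * (sqrt L + sqrt \<mu>))"
  proof -
    have "sqrt L * (sqrt L + sqrt \<mu>) = sqrt L * sqrt L * (1 + sqrt \<mu> / sqrt L)"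
      using \<open>L > 0\<close> by (simp add: distrib_left del: real_sqrt_mult_self)
    also have "\<dots> = L * (1 + sqrt (\<mu> / L))"
      using \<open>L > 0\<close> by (simp add: real_sqrt_divide)
    finally show ?thesis
      by (simp add: s_def r_def mult.commute)
  qed
  finally show "{\<gamma>. is_arg_min (rate_bound L \<mu>) (\<lambda>\<gamma>. \<gamma> \<in> {0<..<2 / L}) \<gamma>} =
      {2 / (sqrt L * (sqrt L + sqrt \<mu>))}" .
qed

end
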